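(* Let $I\subseteq\mathbb{R}$ be an open invex subset with respect to $\eta:I\times I\to\mathbb{R}_+$, let $f:I\to\mathbb{R}$ be an absolutely continuous mapping on $I$, and let $a,b\in I$ with $\eta(b,a)\neq 0$. Let $q>1$ be fixed and $p=\frac{q}{q-1}$. If $|f'|^q$ is prequasiinvex on $I$ with respect to $\eta$, then $$\left|\frac{1}{6}\left[f(a)+4f\left(\frac{2a+\eta(b,a)}{2}\right)+f(a+\eta(b,a))\right]-\frac{1}{\eta(b,a)}\int_a^{a+\eta(b,a)}f(x)\,dx\right|$$ $$\le2\,\eta(b,a)\left(\frac{1+2^{p+1}}{6^{p+1}(p+1)}\right)^{\frac1p}\left(\frac{\max\left\{|f'(a)|^q,|f'(b)|^q\right\}}{2}\right)^{\frac1q}.$$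
   Context: $\mathbb{R}_+=[0,\infty)$. A set $I\subseteq\mathbb{R}$ is invex with respect to $\eta:I\times I\to\mathbb{R}_+$ if $u+t\,\eta(v,u)\in I$ for all $u,v\in I$ and all $t\in[0,1]$. A function $g:I\to\mathbb{R}$ on an invex set $I$ is prequasiinvex with respect to $\eta$ if $g(u+t\,\eta(v,u))\le\max\{g(u),g(v)\}$ for all $u,v\in I$, $t\in[0,1]$. $f'$ is the derivative of $f$; the hypothesis that $|f'|^q$ is prequasiinvex on $I$ presupposes that $f'(x)$ exists at every $x\in I$. *)

theory Defs
  imports "HOL-Analysis.Analysis"
begin

(* The map eta : S x S -> [0, infinity) is curried and totalised; only its values on S x S matter.
   Its nonnegativity on S x S is part of invexity here. *)
definition invex_wrt :: "(real \<Rightarrow> real \<Rightarrow> real) \<Rightarrow> real set \<Rightarrow> bool" where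
  "invex_wrt \<eta> S \<longleftrightarrow>
     (\<forall>u\<in>S. \<forall>v\<in>S. 0 \<le> \<eta> v u) \<and>
     (\<forall>u\<in>S. \<forall>v\<in>S. \<forall>t\<in>{0..1}. u + t * \<eta> v u \<in> S)"

definition prequasiinvex_on ::
  "real set \<Rightarrow> (real \<Rightarrow> real \<Rightarrow> real) \<Rightarrow> (real \<Rightarrow> real) \<Rightarrow> bool" where
  "prequasiinvex_on S \<eta> g \<longleftrightarrow>
     invex_wrt \<eta> S \<and>
     (\<forall>u\<in>S. \<forall>v\<in>S. \<forall>t\<in>{0..1}. g (u + t * \<eta> v u) \<le> max (g u) (g v))"

(* The usual epsilon-delta notion. An invex set need not be an interval, so the finitely many
   non-overlapping intervals are required to lie in S, not merely to have their endpoints there. *)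
definition abs_continuous_on :: "real set \<Rightarrow> (real \<Rightarrow> real) \<Rightarrow> bool" where
  "abs_continuous_on S f \<longleftrightarrow>
     (\<forall>\<epsilon>>0. \<exists>\<delta>>0. \<forall>(n::nat) (\<alpha>::nat \<Rightarrow> real) (\<beta>::nat \<Rightarrow> real).
        (\<forall>k<n. \<alpha> k \<le> \<beta> k \<and> {\<alpha> k..\<beta> k} \<subseteq> S) \<longrightarrow>
        disjoint_family_on (\<lambda>k. {\<alpha> k<..<\<beta> k}) {..<n} \<longrightarrow>
        (\<Sum>k<n. \<beta> k - \<alpha> k) < \<delta> \<longrightarrow>
        (\<Sum>k<n. \<bar>f (\<beta> k) - f (\<alpha> k)\<bar>) < \<epsilon>)"

end

theory Submission
  imports Defs
begin

text \<open>
  On \<open>{a..a + \<eta> b a}\<close> prequasiinvexity gives \<open>\<bar>f' x\<bar> \<le> L\<close>, where \<open>L powr q\<close> is the larger of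
  \<open>\<bar>f' a\<bar> powr q\<close> and \<open>\<bar>f' b\<bar> powr q\<close>; so \<open>f\<close> is \<open>L\<close>-Lipschitz there. This reduces the claim to
  Simpson's rule for Lipschitz functions and an inequality between constants.

  For an interval of length \<open>h\<close>, the Simpson weights \<open>1/6, 4/6, 1/6\<close> are the relative lengths of
  the three pieces obtained by cutting at \<open>h/6\<close> and \<open>5h/6\<close>. Comparing \<open>f\<close> on each piece with its
  value at the node lying in that piece costs at most \<open>L\<close> times the integrated distance to the
  node; the total is \<open>5/36 * h\<^sup>2 * L\<close>, and division by \<open>h\<close> gives lemma \<open>simpson_lipschitz_error\<close>.

  The number \<open>5/36\<close> is the mean, over the unit interval, of the distance from a point to the node
  of its piece, and \<open>C = (1 + 2 powr (p+1)) / (6 powr (p+1) * (p+1))\<close> is half the mean of the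
  \<open>p\<close>-th power of that distance. Since \<open>1/p + 1/q = 1\<close>, the right-hand side of the theorem equals
  \<open>h * (2 * C) powr (1/p) * L\<close>, which is the power-mean bound for the same quantity. Lemma
  \<open>simpson_kernel_power_mean\<close> supplies this bound from the tangent line of \<open>x powr p\<close> at the mean
  \<open>5/36\<close>.
\<close>

text \<open>The integrated form of the convexity of \<open>x powr p\<close>: the tangent at \<open>c\<close> lies below the graph, so
  the difference of the two antiderivatives vanishing at 0 is nondecreasing.\<close>

lemma powr_tangent_integrated:
  fixes p c x :: real
  assumes "p \<ge> 1" "c > 0" "x \<ge> 0"
  shows "c powr p * x + p * c powr (p - 1) * (x\<^sup>2 / 2 - c * x) \<le> x powr (p + 1) / (p + 1)"
proof (cases "x = 0")
  case False
  define G where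
    "G y = y powr (p + 1) / (p + 1) - c powr p * y - p * c powr (p - 1) * (y\<^sup>2 / 2 - c * y)" for y
  have tangent: "c powr p + p * c powr (p - 1) * (y - c) \<le> y powr p" if "y > 0" for y
  proof -
    have "convex_on {0<..} (\<lambda>y. y powr p)"
      using \<open>p \<ge> 1\<close> by (rule powr_convex)
    moreover have "((\<lambda>y. y powr p) has_real_derivative p * c powr (p - 1)) (at c within {0<..})"
      using assms by (auto intro!: derivative_eq_intros)
    ultimately have "p * c powr (p - 1) * (y - c) \<le> y powr p - c powr p"
      using convex_on_imp_above_tangent[of "{0<..}" "\<lambda>y. y powr p" c y] that assms
      by (simp add: interior_open connected_Ioi)
    then show ?thesis
      by simp
  qed
  have "G 0 \<le> G x"
  proof (rule DERIV_nonneg_imp_increasing_open[of 0 x G])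
    show "0 \<le> x" by fact
    show "\<exists>d. (G has_real_derivative d) (at y) \<and> 0 \<le> d" if "0 < y" "y < x" for y
    proof -
      have "((\<lambda>y. y powr (p + 1)) has_real_derivative (p + 1) * y powr p) (at y)"
        using that by (auto intro!: derivative_eq_intros)
      from DERIV_cdivide[OF this, of "p + 1"]
      have "((\<lambda>y. y powr (p + 1) / (p + 1)) has_real_derivative y powr p) (at y)"
        using assms(1) by simp
      moreover have "((\<lambda>y. c powr p * y) has_real_derivative c powr p) (at y)"
        by (auto intro!: derivative_eq_intros)
      moreover have "((\<lambda>y. p * c powr (p - 1) * (y\<^sup>2 / 2 - c * y)) has_real_derivative
          p * c powr (p - 1) * (y - c)) (at y)"
        by (auto intro!: derivative_eq_intros)
      ultimately have
        "(G has_real_derivative y powr p - c powr p - p * c powr (p - 1) * (y - c)) (at y)"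
        unfolding G_def by (intro DERIV_diff)
      then show ?thesis
        using tangent[OF \<open>0 < y\<close>] by (intro exI conjI) auto
    qed
    show "continuous_on {0..x} G"
      unfolding G_def using assms
      by (intro continuous_on_diff continuous_on_divide continuous_on_powr' continuous_intros) auto
  qed
  then show ?thesis
    using assms by (simp add: G_def)
qed (use assms in simp)

text \<open>On one half of the unit interval, the distance to the node of the piece runs linearly through
  \<open>{0..1/6}\<close> on the outer piece and through \<open>{0..1/3}\<close> on the central one. In the sum of the
  integrated tangent bounds for the two ranges the term with factor \<open>p\<close> cancels, because the
  tangent is taken at the mean \<open>5/36\<close> of the distance.\<close>

lemma simpson_kernel_power_mean:
  fixes p :: real
  assumes "p \<ge> 1"
  shows "(5 / 36) powr p / 2 \<le> (1 + 2 powr (p + 1)) / (6 powr (p + 1) * (p + 1))"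
proof -
  have "(5 / 36) powr p / 2 \<le> (1 / 6) powr (p + 1) / (p + 1) + (1 / 3) powr (p + 1) / (p + 1)"
    using powr_tangent_integrated[of p "5/36" "1/6"] powr_tangent_integrated[of p "5/36" "1/3"] assms
    by (simp add: power2_eq_square)
  also have "\<dots> = (1 + 2 powr (p + 1)) / (6 powr (p + 1) * (p + 1))"
    using powr_divide[of 1 6 "p + 1"] powr_divide[of 2 6 "p + 1"] by (simp add: add_divide_distrib)
  finally show ?thesis .
qed

lemma has_integral_distance_to_point:
  fixes u v w :: real
  assumes "u \<le> w" "w \<le> v"
  shows "((\<lambda>x. \<bar>x - w\<bar>) has_integral ((w - u)\<^sup>2 + (v - w)\<^sup>2) / 2) {u..v}"
proof -
  have "((\<lambda>x. w - x) has_integral (- (w - w)\<^sup>2 / 2 - - (w - u)\<^sup>2 / 2)) {u..w}"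
    by (rule fundamental_theorem_of_calculus[OF assms(1)])
      (auto simp flip: has_real_derivative_iff_has_vector_derivative intro!: derivative_eq_intros simp: field_simps)
  then have left: "((\<lambda>x. \<bar>x - w\<bar>) has_integral (w - u)\<^sup>2 / 2) {u..w}"
    by (rule has_integral_eq[rotated, where f = "\<lambda>x. w - x", THEN has_integral_eq_rhs]) auto
  have "((\<lambda>x. x - w) has_integral ((v - w)\<^sup>2 / 2 - (w - w)\<^sup>2 / 2)) {w..v}"
    by (rule fundamental_theorem_of_calculus[OF assms(2)])
      (auto simp flip: has_real_derivative_iff_has_vector_derivative intro!: derivative_eq_intros simp: field_simps)
  then have right: "((\<lambda>x. \<bar>x - w\<bar>) has_integral (v - w)\<^sup>2 / 2) {w..v}"
    by (rule has_integral_eq[rotated, where f = "\<lambda>x. x - w", THEN has_integral_eq_rhs]) auto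
  show ?thesis
    using has_integral_combine[OF assms left right] by (simp add: add_divide_distrib)
qed

lemma one_node_lipschitz_error:
  fixes f :: "real \<Rightarrow> real"
  assumes "u \<le> w" "w \<le> v" and lip: "L-lipschitz_on {u..v} f"
  shows "\<bar>integral {u..v} f - (v - u) * f w\<bar> \<le> L * (((w - u)\<^sup>2 + (v - w)\<^sup>2) / 2)"
proof -
  have f_int: "f integrable_on {u..v}"
    using lipschitz_on_continuous_on[OF lip] by (rule integrable_continuous_interval)
  have diff: "((\<lambda>x. f x - f w) has_integral (integral {u..v} f - (v - u) * f w)) {u..v}"
    using has_integral_diff[OF integrable_integral[OF f_int] has_integral_const_real[of "f w" u v]] assms
    by simp
  have dist: "((\<lambda>x. L * \<bar>x - w\<bar>) has_integral L * (((w - u)\<^sup>2 + (v - w)\<^sup>2) / 2)) {u..v}"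
    using has_integral_mult_right[OF has_integral_distance_to_point[OF assms(1,2)]] .
  have "norm (integral {u..v} (\<lambda>x. f x - f w)) \<le> integral {u..v} (\<lambda>x. L * \<bar>x - w\<bar>)"
    using diff dist lipschitz_onD[OF lip, of _ w] assms(1,2)
    by (intro integral_norm_bound_integral) (auto simp: has_integral_integrable dist_real_def)
  then show ?thesis
    unfolding integral_unique[OF diff] integral_unique[OF dist] real_norm_def .
qed

lemma simpson_lipschitz_error:
  fixes f :: "real \<Rightarrow> real" and a h L :: real
  assumes "h > 0" and lip: "L-lipschitz_on {a..a + h} f"
  shows "\<bar>1 / 6 * (f a + 4 * f (a + h / 2) + f (a + h)) - 1 / h * integral {a..a + h} f\<bar>
           \<le> 5 / 36 * h * L"
proof -
  \<comment> \<open>The cuts that give each node a piece of length equal to its Simpson weight times \<open>h\<close>.\<close>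
  define s t where "s = a + h / 6" and "t = a + 5 * h / 6"
  have f_int: "f integrable_on {a..a + h}"
    using lipschitz_on_continuous_on[OF lip] by (rule integrable_continuous_interval)
  have order: "a \<le> s" "s \<le> a + h / 2" "a + h / 2 \<le> t" "t \<le> a + h" "s \<le> t" "s \<le> a + h"
    using assms(1) by (auto simp: s_def t_def)
  have "integral {a..s} f + integral {s..a + h} f = integral {a..a + h} f"
    using order f_int by (intro Henstock_Kurzweil_Integration.integral_combine) auto
  moreover have "integral {s..t} f + integral {t..a + h} f = integral {s..a + h} f"
    using order
    by (intro Henstock_Kurzweil_Integration.integral_combine integrable_on_subinterval[OF f_int]) auto
  moreover have "\<bar>integral {a..s} f - h / 6 * f a\<bar> \<le> L * (h\<^sup>2 / 72)"
    using one_node_lipschitz_error[OF _ _ lipschitz_on_subset[OF lip], of a a s] order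
    by (auto simp: s_def t_def power2_eq_square)
  moreover have "\<bar>integral {s..t} f - 4 * h / 6 * f (a + h / 2)\<bar> \<le> L * (h\<^sup>2 / 9)"
    using one_node_lipschitz_error[OF _ _ lipschitz_on_subset[OF lip], of s "a + h / 2" t] order
    by (auto simp: s_def t_def power2_eq_square field_simps)
  moreover have "\<bar>integral {t..a + h} f - h / 6 * f (a + h)\<bar> \<le> L * (h\<^sup>2 / 72)"
    using one_node_lipschitz_error[OF _ _ lipschitz_on_subset[OF lip], of t "a + h" "a + h"] order
    by (auto simp: s_def t_def power2_eq_square field_simps)
  ultimately have
    "\<bar>h / 6 * f a + 4 * h / 6 * f (a + h / 2) + h / 6 * f (a + h) - integral {a..a + h} f\<bar>
       \<le> 5 / 36 * (L * h\<^sup>2)"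
    by linarith
  also have "h / 6 * f a + 4 * h / 6 * f (a + h / 2) + h / 6 * f (a + h) - integral {a..a + h} f
    = h * (1 / 6 * (f a + 4 * f (a + h / 2) + f (a + h)) - 1 / h * integral {a..a + h} f)"
    using assms(1) by (simp add: field_simps)
  also have "5 / 36 * (L * h\<^sup>2) = h * (5 / 36 * h * L)"
    by (simp add: power2_eq_square)
  finally show ?thesis
    using assms(1) by (simp only: abs_mult abs_of_pos mult_le_cancel_left_pos)
qed

text \<open>The points of \<open>{a..a + \<eta> b a}\<close> are exactly the points \<open>a + t * \<eta> b a\<close> at which prequasiinvexity
  controls the derivative; the mean value theorem turns this control into a Lipschitz constant.\<close>

lemma prequasiinvex_powr_imp_lipschitz:
  fixes f f' :: "real \<Rightarrow> real"
  assumes deriv: "\<And>x. x \<in> I \<Longrightarrow> (f has_real_derivative f' x) (at x)"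
    and "a \<in> I" "b \<in> I" "\<eta> b a > 0" "q > 0"
    and prequasi: "prequasiinvex_on I \<eta> (\<lambda>x. \<bar>f' x\<bar> powr q)"
  shows "(max (\<bar>f' a\<bar> powr q) (\<bar>f' b\<bar> powr q) powr (1 / q))-lipschitz_on {a..a + \<eta> b a} f"
proof (rule lipschitz_onI)
  define K where "K = max (\<bar>f' a\<bar> powr q) (\<bar>f' b\<bar> powr q)"
  have on_path: "x \<in> I \<and> \<bar>f' x\<bar> \<le> K powr (1 / q)" if "x \<in> {a..a + \<eta> b a}" for x
  proof -
    have t: "(x - a) / \<eta> b a \<in> {0..1}" "x = a + (x - a) / \<eta> b a * \<eta> b a"
      using that \<open>\<eta> b a > 0\<close> by auto
    have "x \<in> I \<and> \<bar>f' x\<bar> powr q \<le> K"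
      using prequasi t \<open>a \<in> I\<close> \<open>b \<in> I\<close> unfolding prequasiinvex_on_def invex_wrt_def K_def by metis
    moreover from this have "(\<bar>f' x\<bar> powr q) powr (1 / q) \<le> K powr (1 / q)"
      using \<open>q > 0\<close> by (intro powr_mono2) auto
    ultimately show ?thesis
      using \<open>q > 0\<close> by (simp add: powr_powr)
  qed
  show "dist (f x) (f y) \<le> max (\<bar>f' a\<bar> powr q) (\<bar>f' b\<bar> powr q) powr (1 / q) * dist x y"
    if "x \<in> {a..a + \<eta> b a}" "y \<in> {a..a + \<eta> b a}" for x y
    using field_differentiable_bound[of "{a..a + \<eta> b a}" f f' "K powr (1 / q)" x y] that on_path deriv
    by (auto simp: dist_norm K_def intro: has_field_derivative_at_within)
qed auto

theorem theorem6:
  fixes I :: "real set" and \<eta> :: "real \<Rightarrow> real \<Rightarrow> real"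
    and f f' :: "real \<Rightarrow> real" and a b p q :: real
  assumes "open I"
    and "invex_wrt \<eta> I"
    and "abs_continuous_on I f"
    and "\<And>x. x \<in> I \<Longrightarrow> (f has_real_derivative f' x) (at x)"
    and "a \<in> I" and "b \<in> I" and "\<eta> b a \<noteq> 0"
    and "q > 1" and "p = q / (q - 1)"
    and "prequasiinvex_on I \<eta> (\<lambda>x. \<bar>f' x\<bar> powr q)"
  shows "\<bar>1 / 6 * (f a + 4 * f ((2 * a + \<eta> b a) / 2) + f (a + \<eta> b a))
            - 1 / \<eta> b a * integral {a..a + \<eta> b a} f\<bar>
         \<le> 2 * \<eta> b a
            * ((1 + 2 powr (p + 1)) / (6 powr (p + 1) * (p + 1))) powr (1 / p)
            * (max (\<bar>f' a\<bar> powr q) (\<bar>f' b\<bar> powr q) / 2) powr (1 / q)"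
proof -
  define h where "h = \<eta> b a"
  define L where "L = max (\<bar>f' a\<bar> powr q) (\<bar>f' b\<bar> powr q) powr (1 / q)"
  define C where "C = (1 + 2 powr (p + 1)) / (6 powr (p + 1) * (p + 1))"
  have "h > 0"
    using assms unfolding invex_wrt_def h_def by (metis order_le_less)
  have "p > 1" and conj: "1 / p + 1 / q = 1"
    using assms(8) unfolding assms(9) by (simp_all add: field_simps)
  have "L-lipschitz_on {a..a + h} f"
    using prequasiinvex_powr_imp_lipschitz[OF assms(4,5,6) _ _ assms(10)] \<open>h > 0\<close> \<open>q > 1\<close>
    unfolding L_def h_def by simp
  from simpson_lipschitz_error[OF \<open>h > 0\<close> this]
  have error: "\<bar>1 / 6 * (f a + 4 * f ((2 * a + h) / 2) + f (a + h)) - 1 / h * integral {a..a + h} f\<bar>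
      \<le> 5 / 36 * h * L"
    by (simp add: add_divide_distrib)
  have "5 / 36 * (1 / 2) powr (1 / p) = ((5 / 36) powr p / 2) powr (1 / p)"
    using \<open>p > 1\<close> powr_mult[of "(5 / 36) powr p" "1 / 2" "1 / p"] by (simp add: powr_powr)
  also have "\<dots> \<le> C powr (1 / p)"
    using simpson_kernel_power_mean[of p] \<open>p > 1\<close> by (intro powr_mono2) (auto simp: C_def)
  \<comment> \<open>The two powers of \<open>1/2\<close> combine to \<open>1/2\<close>, as \<open>p\<close> and \<open>q\<close> are conjugate.\<close>
  finally have "5 / 36 * (1 / 2) powr (1 / p) * (1 / 2) powr (1 / q)
      \<le> C powr (1 / p) * (1 / 2) powr (1 / q)"
    by (rule mult_right_mono) simp
  then have "5 / 72 \<le> C powr (1 / p) * (1 / 2) powr (1 / q)"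
    using conj by (simp add: mult.assoc flip: powr_add)
  then have "(2 * h * L) * (5 / 72) \<le> (2 * h * L) * (C powr (1 / p) * (1 / 2) powr (1 / q))"
    using \<open>h > 0\<close> by (intro mult_left_mono) (auto simp: L_def)
  also have "\<dots> = 2 * h * C powr (1 / p)
      * (max (\<bar>f' a\<bar> powr q) (\<bar>f' b\<bar> powr q) / 2) powr (1 / q)"
    by (simp add: L_def powr_divide)
  finally show ?thesis
    using error unfolding h_def C_def by linarith
qed

end
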